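(* Let $s<1$ be real and $\Re x>0$. Then $$\Gamma(1-s)\,\mathrm{e}^x x^{-s}\,\Gamma(s,x)=\mathcal{L}\big[\mathrm{Li}_s(\mathrm{e}^{-p-1})\big](x)-\sum_{k=1}^{\infty}2^{-k(1-s)}\,\mathcal{L}\big[\mathrm{Li}_s\big(-\mathrm{e}^{-2^{-k}(p+1)}\big)\big](x),$$ and in particular $$\pi\,\mathrm{e}^x x^{-1/2}\,\mathrm{erfc}(\sqrt{x})=\mathcal{L}\big[\mathrm{Li}_{1/2}(\mathrm{e}^{-p-1})\big](x)-\sum_{k=1}^{\infty}2^{-k/2}\,\mathcal{L}\big[\mathrm{Li}_{1/2}\big(-\mathrm{e}^{-2^{-k}(p+1)}\big)\big](x).$$
   Context: $\Gamma(s,x)=\int_x^\infty t^{s-1}\mathrm{e}^{-t}\,dt$ is the incomplete gamma function, $\mathrm{erfc}(x)=\frac{2}{\sqrt\pi}\int_x^\infty\mathrm{e}^{-t^2}dt$, principal branches of powers are used. $\mathrm{Li}_s(z)=\sum_{n=1}^\infty n^{-s}z^n$ for $|z|<1$. $\mathcal{L}[G](x)=\int_0^\infty G(p)\mathrm{e}^{-px}\,dp$ is the Laplace transform in $p$. *)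

theory Defs
  imports "HOL-Complex_Analysis.Complex_Analysis"
begin

text \<open>The integral of \<open>f\<close> from the complex point \<open>z\<close> to \<open>+\<infinity>\<close>: the limit, as \<open>R \<rightarrow> +\<infinity>\<close> along
  the reals, of the integral over the segment from \<open>z\<close> to \<open>R\<close>. If \<open>z\<close> lies off \<open>(-\<infinity>, 0]\<close>,
  this segment lies in the domain of analyticity of the principal branches of powers
  for all \<open>R > 0\<close>.\<close>

definition integral_to_infinity :: "(complex \<Rightarrow> complex) \<Rightarrow> complex \<Rightarrow> complex" where
  "integral_to_infinity f z =
     Lim at_top (\<lambda>R::real. contour_integral (linepath z (complex_of_real R)) f)"

definition incomplete_Gamma :: "complex \<Rightarrow> complex \<Rightarrow> complex" where
  "incomplete_Gamma s x = integral_to_infinity (\<lambda>t. t powr (s - 1) * exp (- t)) x"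

definition erfc :: "complex \<Rightarrow> complex" where
  "erfc x = 2 / complex_of_real (sqrt pi) * integral_to_infinity (\<lambda>t. exp (- (t\<^sup>2))) x"

text \<open>Only meaningful for \<open>norm z < 1\<close>.\<close>

definition polylog :: "complex \<Rightarrow> complex \<Rightarrow> complex" where
  "polylog s z = (\<Sum>n. of_nat (Suc n) powr (- s) * z ^ Suc n)"

definition laplace_convergent :: "(real \<Rightarrow> complex) \<Rightarrow> complex \<Rightarrow> bool" where
  "laplace_convergent G x \<longleftrightarrow>
     set_integrable lborel {0..} (\<lambda>p. G p * exp (- (complex_of_real p * x)))"

definition laplace :: "(real \<Rightarrow> complex) \<Rightarrow> complex \<Rightarrow> complex" where
  "laplace G x = (LINT p:{0..}|lborel. G p * exp (- (complex_of_real p * x)))"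

end

theory Submission
  imports Defs "HOL-Real_Asymp.Real_Asymp"
begin

text \<open>Iterating the duplication formula \<open>Li\<^sub>s(z) + Li\<^sub>s(-z) = 2\<^bsup>1-s\<^esup> Li\<^sub>s(z\<^sup>2)\<close> from
  \<open>z = e\<^bsup>-q\<^esup>\<close> telescopes the series: the \<open>N\<close>-th remainder is \<open>2\<^bsup>-N(1-s)\<^esup> Li\<^sub>s(exp(-2\<^bsup>-N\<^esup> q))\<close>.
  An Abelian comparison of \<open>Li\<^sub>s\<close> with the binomial series of \<open>(1-z)\<^bsup>s-1\<^esup>\<close> shows that this
  remainder tends to \<open>\<Gamma>(1-s) q\<^bsup>s-1\<^esup>\<close>. On \<open>q \<ge> 1\<close> it is bounded by its value at \<open>q = 1\<close>, so
  dominated convergence carries the limit through the Laplace transform. Finally, the transform of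
  \<open>(p+1)\<^bsup>s-1\<^esup>\<close> is the integral of \<open>t\<^bsup>s-1\<^esup> e\<^bsup>-t\<^esup>\<close> along the ray through \<open>x\<close>, which may
  be turned into the real direction; substituting \<open>t = w\<^sup>2\<close> gives the case of erfc.\<close>

section \<open>Abelian comparison and the growth of the polylogarithm at 1\<close>

text \<open>The quotient is a mean of the \<open>c n\<close> with nonnegative weights
  \<open>b n * z ^ n / B z\<close> of total 1. As \<open>B z\<close> grows without bound, every
  finite block of indices loses its weight, and only the tail, where \<open>c n\<close> is near
  \<open>L\<close>, counts.\<close>

lemma tendsto_powser_quotient:
  fixes b c :: "nat \<Rightarrow> real" and B :: "real \<Rightarrow> real"
  assumes nonneg: "\<And>n. b n \<ge> 0" and c: "c \<longlonglongrightarrow> L"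
    and B: "\<And>z. 0 < z \<Longrightarrow> z < 1 \<Longrightarrow> (\<lambda>n. b n * z ^ n) sums B z"
    and B_lim: "filterlim B at_top (at_left 1)"
  shows "((\<lambda>z. (\<Sum>n. c n * b n * z ^ n) / B z) \<longlongrightarrow> L) (at_left 1)"
proof (rule tendstoI)
  fix e :: real assume e: "e > 0"
  obtain N where N: "\<And>n. n \<ge> N \<Longrightarrow> \<bar>c n - L\<bar> < e / 2"
    using LIMSEQ_D[OF c, of "e / 2"] e by (auto simp: real_norm_def)
  define K where "K = (\<Sum>n<N. \<bar>c n - L\<bar> * b n)"
  have K: "K \<ge> 0" unfolding K_def by (intro sum_nonneg mult_nonneg_nonneg nonneg) auto
  obtain M where M: "\<And>n. \<bar>c n\<bar> \<le> M"
    using convergent_imp_Bseq[of c] c by (auto simp: convergent_def Bseq_def)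
  \<comment> \<open>Past this threshold \<open>K < e / 2 * B z\<close>. Since
    \<open>z ^ n \<le> 1\<close>, the head of the series contributes at most \<open>K\<close>; the
    tail takes the other half of \<open>e\<close>.\<close>
  have ev1: "\<forall>\<^sub>F z in at_left 1. B z > 2 * K / e"
    using B_lim by (auto simp: filterlim_at_top_dense)
  have ev2: "\<forall>\<^sub>F z in at_left (1::real). z > 0"
    by (rule eventually_at_left_real[THEN eventually_mono, of 0]) auto
  have ev3: "\<forall>\<^sub>F z in at_left (1::real). z < 1"
    by (simp add: eventually_at_filter)
  show "\<forall>\<^sub>F z in at_left 1. dist ((\<Sum>n. c n * b n * z ^ n) / B z) L < e"
    using ev1 ev2 ev3
  proof eventually_elim
    case (elim z)
    have Bz: "B z > 0" using elim(1) K e by (smt (verit) divide_nonneg_pos)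
    have sB: "summable (\<lambda>n. b n * z ^ n)" "B z = (\<Sum>n. b n * z ^ n)"
      using B[of z] elim by (auto simp: sums_iff)
    have s1: "summable (\<lambda>n. c n * b n * z ^ n)"
    proof (rule summable_comparison_test')
      show "summable (\<lambda>n. M * (b n * z ^ n))" using sB by (intro summable_mult)
      show "norm (c n * b n * z ^ n) \<le> M * (b n * z ^ n)" if "n \<ge> 0" for n
        using mult_right_mono[OF M[of n], of "b n * z ^ n"] nonneg[of n] elim
        by (simp add: abs_mult)
    qed
    have sL: "summable (\<lambda>n. L * (b n * z ^ n))" using sB by (intro summable_mult)
    have sd: "summable (\<lambda>n. (c n - L) * b n * z ^ n)"
      using summable_diff[OF s1 sL] by (simp add: algebra_simps)
    have eq: "(\<Sum>n. c n * b n * z ^ n) - L * B z = (\<Sum>n. (c n - L) * b n * z ^ n)"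
      using suminf_diff[OF s1 sL] suminf_mult[OF sB(1), of L] sB(2) by (simp add: algebra_simps)
    \<comment> \<open>The head bound is padded with zeros to a series, so that one termwise majorant
      covers both ranges of \<open>n\<close>.\<close>
    define u where "u = (\<lambda>n. if n < N then \<bar>c n - L\<bar> * b n else 0)"
    have u: "u sums K" unfolding u_def K_def
      using sums_If_finite[of "\<lambda>n. n < N" "\<lambda>n. \<bar>c n - L\<bar> * b n"] by (simp add: lessThan_def)
    have v: "(\<lambda>n. u n + e / 2 * (b n * z ^ n)) sums (K + e / 2 * B z)"
      using B[of z] elim by (intro sums_add u sums_mult) auto
    have bd: "norm ((c n - L) * b n * z ^ n) \<le> u n + e / 2 * (b n * z ^ n)" for n
    proof (cases "n < N")
      case True
      have "\<bar>c n - L\<bar> * b n * z ^ n \<le> \<bar>c n - L\<bar> * b n * 1"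
        using nonneg[of n] elim by (intro mult_left_mono power_le_one) auto
      moreover have "e / 2 * (b n * z ^ n) \<ge> 0" using e nonneg[of n] elim by simp
      ultimately show ?thesis using True nonneg[of n] elim by (simp add: u_def abs_mult)
    next
      case False
      then have "\<bar>c n - L\<bar> * (b n * z ^ n) \<le> e / 2 * (b n * z ^ n)"
        using N[of n] nonneg[of n] elim by (intro mult_right_mono) auto
      then show ?thesis using False nonneg[of n] elim by (simp add: u_def abs_mult)
    qed
    have "\<bar>\<Sum>n. (c n - L) * b n * z ^ n\<bar> \<le> K + e / 2 * B z"
      using norm_suminf_le[OF bd sums_summable[OF v]] v by (simp add: sums_iff)
    also have "\<dots> < e * B z" using elim(1) e by (simp add: field_simps)
    finally have "\<bar>(\<Sum>n. c n * b n * z ^ n) - L * B z\<bar> < e * B z" by (simp add: eq)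
    moreover have "(\<Sum>n. c n * b n * z ^ n) / B z - L = ((\<Sum>n. c n * b n * z ^ n) - L * B z) / B z"
      using Bz by (simp add: field_simps)
    ultimately show ?case using Bz by (simp add: dist_real_def abs_div_pos[symmetric] pos_divide_less_eq)
  qed
qed

text \<open>Newton's series at \<open>- z\<close> with exponent \<open>- a\<close>: the sign
  \<open>(- 1) ^ n\<close> in \<open>- a gchoose n\<close> cancels that of \<open>(- z) ^ n\<close>,
  which leaves positive coefficients for \<open>a > 0\<close>.\<close>

lemma binomial_series_pochhammer:
  fixes a z :: real
  assumes "\<bar>z\<bar> < 1"
  shows "(\<lambda>n. pochhammer a n / fact n * z ^ n) sums (1 - z) powr (- a)"
proof -
  have "(- a gchoose n) * (- z) ^ n = pochhammer a n / fact n * z ^ n" for n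
  proof -
    have "(- 1) ^ n * (- z) ^ n = z ^ n" by (simp flip: power_mult_distrib)
    then show ?thesis unfolding gbinomial_pochhammer by (metis minus_minus mult.assoc mult.commute times_divide_eq_left)
  qed
  with gen_binomial_real[of "- z" "- a"] assms show ?thesis by simp
qed

text \<open>Euler's limit \<open>Gamma_series\<close> has \<open>n powr a\<close> over
  \<open>pochhammer a (n + 1)\<close>. The factor \<open>(a + n) / n\<close>, which tends to 1,
  removes the last Pochhammer factor and one power of \<open>n\<close>.\<close>

lemma power_over_pochhammer_tendsto_Gamma:
  fixes a :: real
  assumes "a > 0"
  shows "(\<lambda>n. real n powr (a - 1) / (pochhammer a n / fact n)) \<longlonglongrightarrow> Gamma a"
proof -
  have "(\<lambda>n. Gamma_series a n * ((a + real n) / real n)) \<longlonglongrightarrow> Gamma a * 1"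
    by (intro tendsto_mult Gamma_series_LIMSEQ) real_asymp
  moreover have "\<forall>\<^sub>F n in sequentially. Gamma_series a n * ((a + real n) / real n) =
      real n powr (a - 1) / (pochhammer a n / fact n)"
    using eventually_gt_at_top[of 0]
  proof eventually_elim
    case (elim n)
    have "pochhammer a n > 0" using assms by (rule pochhammer_pos)
    moreover have "a + real n > 0" using assms by simp
    ultimately show ?case using elim
      by (simp add: Gamma_series_def pochhammer_Suc powr_diff powr_def[of _ a] divide_simps)
  qed
  ultimately have "(\<lambda>n. real n powr (a - 1) / (pochhammer a n / fact n)) \<longlonglongrightarrow> Gamma a * 1"
    by (rule Lim_transform_eventually)
  then show ?thesis by simp
qed

text \<open>The term for \<open>n = 0\<close> vanishes because \<open>0 powr a = 0\<close> for every \<open>a\<close>, including \<open>a = 0\<close>.\<close>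

definition real_polylog :: "real \<Rightarrow> real \<Rightarrow> real" where
  "real_polylog s z = (\<Sum>n. real n powr (- s) * z ^ n)"

text \<open>With \<open>a = 1 - s\<close>, the coefficients \<open>n powr (- s)\<close> are
  asymptotically \<open>Gamma (1 - s)\<close> times those of \<open>(1 - z) powr (s - 1)\<close>,
  which tends to infinity at 1 because \<open>s < 1\<close>.\<close>

lemma real_polylog_tendsto_Gamma:
  assumes "s < 1"
  shows "((\<lambda>z. (1 - z) powr (1 - s) * real_polylog s z) \<longlongrightarrow> Gamma (1 - s)) (at_left 1)"
proof -
  let ?b = "\<lambda>n. pochhammer (1 - s) n / fact n"
  let ?c = "\<lambda>n. real n powr (- s) / ?b n"
  have b: "?b n > 0" for n using assms by (intro divide_pos_pos pochhammer_pos) auto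
  have c: "?c \<longlonglongrightarrow> Gamma (1 - s)"
    using power_over_pochhammer_tendsto_Gamma[of "1 - s"] assms by simp
  have "filterlim (\<lambda>z. (1 - z) powr (- (1 - s))) at_top (at_left (1::real))"
    using assms by real_asymp
  then have "((\<lambda>z. (\<Sum>n. ?c n * ?b n * z ^ n) / (1 - z) powr (- (1 - s))) \<longlongrightarrow> Gamma (1 - s)) (at_left 1)"
    by (intro tendsto_powser_quotient c binomial_series_pochhammer less_imp_le[OF b]) auto
  moreover have "?c n * ?b n = real n powr (- s)" for n
    using less_imp_neq[OF b[of n]] by (metis nonzero_eq_divide_eq)
  ultimately have "((\<lambda>z. real_polylog s z / (1 - z) powr (- (1 - s))) \<longlongrightarrow> Gamma (1 - s)) (at_left 1)"
    by (simp only: real_polylog_def)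
  then show ?thesis
    unfolding powr_minus[of _ "1 - s"] by (simp only: divide_inverse inverse_inverse_eq mult.commute)
qed

section \<open>Convergence, bounds and duplication for the polylogarithm\<close>

lemma summable_real_polylog:
  assumes "\<bar>z\<bar> < 1"
  shows "summable (\<lambda>n. real n powr (- s) * z ^ n)"
proof -
  \<comment> \<open>A positive \<open>r\<close> covers zero and negative \<open>z\<close> too, and
    can be written as \<open>exp (- q)\<close>, whose powers beat any power of
    \<open>n\<close>.\<close>
  obtain r where r: "\<bar>z\<bar> < r" "r < 1" using assms dense by blast
  define q where "q = - ln r"
  have q: "q > 0" "r = exp (- q)" using r by (auto simp: q_def)
  have "(\<lambda>n. real n powr (- s) * exp (- q) ^ n) \<in> O(\<lambda>n. 1 / real n ^ 2)"
    using q(1) by real_asymp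
  moreover have "summable (\<lambda>n. norm (1 / real n ^ 2))"
    using inverse_power_summable[of 2, where 'a = real] by (simp add: field_simps)
  ultimately have "summable (\<lambda>n. real n powr (- s) * r ^ n)"
    unfolding q(2) by (rule summable_comparison_test_bigo[rotated])
  then show ?thesis
  proof (rule summable_comparison_test'[where N = 0])
    show "norm (real n powr (- s) * z ^ n) \<le> real n powr (- s) * r ^ n" for n
      using r by (auto simp: abs_mult power_abs intro!: mult_left_mono power_mono)
  qed
qed

lemma abs_real_polylog_le:
  assumes "\<bar>z\<bar> \<le> r" "r < 1"
  shows "\<bar>real_polylog s z\<bar> \<le> real_polylog s r"
  unfolding real_polylog_def real_norm_def[symmetric]
proof (rule norm_suminf_le)
  show "norm (real n powr (- s) * z ^ n) \<le> real n powr (- s) * r ^ n" for n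
    using assms by (auto simp: abs_mult power_abs intro!: mult_left_mono power_mono)
  show "summable (\<lambda>n. real n powr (- s) * r ^ n)"
    using assms by (intro summable_real_polylog) auto
qed

text \<open>Only real arguments occur in the transforms, so the series arguments can stay over the
  reals. The shift of index is harmless, as the term at 0 vanishes.\<close>

lemma polylog_of_real:
  assumes "\<bar>z\<bar> < 1"
  shows "polylog (of_real s) (of_real z) = of_real (real_polylog s z)"
proof -
  have "of_nat (Suc n) powr (- of_real s) = (of_real (real (Suc n) powr (- s)) :: complex)" for n
    using powr_of_real[of "real (Suc n)" "- s"] by simp
  then have "polylog (of_real s) (of_real z) = (\<Sum>n. of_real (real (Suc n) powr (- s) * z ^ Suc n))"
    unfolding polylog_def by simp
  also have "\<dots> = of_real (\<Sum>n. real (Suc n) powr (- s) * z ^ Suc n)"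
    using summable_real_polylog[OF assms, of s]
    by (intro suminf_of_real[symmetric]) (subst summable_Suc_iff)
  also have "(\<Sum>n. real (Suc n) powr (- s) * z ^ Suc n) = real_polylog s z"
    unfolding real_polylog_def using suminf_split_head[OF summable_real_polylog[OF assms, of s]]
    by simp
  finally show ?thesis .
qed

text \<open>Odd powers of \<open>z\<close> cancel; terms of even index \<open>2 * n\<close> double,
  and their coefficients release the factor \<open>2 powr (- s)\<close>.\<close>

lemma real_polylog_duplication:
  assumes "\<bar>z\<bar> < 1"
  shows "real_polylog s z + real_polylog s (- z) = 2 powr (1 - s) * real_polylog s (z\<^sup>2)"
proof -
  have z2: "\<bar>z\<^sup>2\<bar> < 1" using assms by (simp add: abs_square_less_1)
  let ?f = "\<lambda>n. real n powr (- s) * z ^ n + real n powr (- s) * (- z) ^ n"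
  have f: "?f sums (real_polylog s z + real_polylog s (- z))"
    unfolding real_polylog_def using assms
    by (intro sums_add summable_sums summable_real_polylog) auto
  have "(\<lambda>n. ?f (2 * n)) sums (real_polylog s z + real_polylog s (- z))"
    using f
  proof (subst sums_mono_reindex)
    show "?f n = 0" if "n \<notin> range ((*) 2)" for n
    proof -
      have "odd n" using that by (auto elim!: evenE)
      then show ?thesis by simp
    qed
  qed (auto simp: strict_mono_def)
  moreover have "?f (2 * n) = 2 powr (1 - s) * (real n powr (- s) * (z\<^sup>2) ^ n)" for n
  proof -
    have "z ^ (2 * n) = (z\<^sup>2) ^ n" "(- z) ^ (2 * n) = (z\<^sup>2) ^ n"
      by (simp_all add: power_mult)
    then show ?thesis by (simp add: powr_mult powr_diff powr_minus field_simps)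
  qed
  ultimately have "(\<lambda>n. 2 powr (1 - s) * (real n powr (- s) * (z\<^sup>2) ^ n)) sums
      (real_polylog s z + real_polylog s (- z))" by simp
  moreover have "(\<lambda>n. 2 powr (1 - s) * (real n powr (- s) * (z\<^sup>2) ^ n)) sums
      (2 powr (1 - s) * real_polylog s (z\<^sup>2))"
    unfolding real_polylog_def using z2
    by (intro sums_mult summable_sums summable_real_polylog)
  ultimately show ?thesis by (rule sums_unique2)
qed

section \<open>The telescoping remainder\<close>

text \<open>In the application \<open>q\<close> is \<open>p + 1\<close>. At \<open>N = 0\<close>
  both powers of 2 equal 1, which gives the integrand of the first transform.\<close>

definition polylog_remainder :: "real \<Rightarrow> nat \<Rightarrow> real \<Rightarrow> real" where
  "polylog_remainder s N q = 2 powr (- real N * (1 - s)) * real_polylog s (exp (- (2 powr (- real N) * q)))"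

text \<open>This is the duplication formula at \<open>exp (- (2 powr (- real (Suc N)) * q))\<close>,
  whose square is the argument at level \<open>N\<close>.\<close>

lemma polylog_remainder_step:
  assumes "q > 0"
  shows "polylog_remainder s N q - polylog_remainder s (Suc N) q =
    2 powr (- real (Suc N) * (1 - s)) * real_polylog s (- exp (- (2 powr (- real (Suc N)) * q)))"
proof -
  let ?z = "exp (- (2 powr (- real (Suc N)) * q))"
  have "?z\<^sup>2 = exp (- (2 powr (- real N) * q))"
    by (simp add: exp_double[symmetric] powr_diff powr_minus field_simps)
  moreover have "\<bar>?z\<bar> < 1" using assms by simp
  ultimately have dup: "real_polylog s ?z + real_polylog s (- ?z) =
      2 powr (1 - s) * real_polylog s (exp (- (2 powr (- real N) * q)))"
    using real_polylog_duplication[of ?z s] by simp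
  have "2 powr (- real N * (1 - s)) = 2 powr (- real (Suc N) * (1 - s)) * 2 powr (1 - s)"
    by (simp add: powr_add[symmetric] algebra_simps)
  then have "polylog_remainder s N q = 2 powr (- real (Suc N) * (1 - s)) *
      (real_polylog s ?z + real_polylog s (- ?z))"
    unfolding polylog_remainder_def dup by simp
  then show ?thesis unfolding polylog_remainder_def by (simp add: algebra_simps)
qed

text \<open>With \<open>z\<close> the argument at level \<open>N\<close>, the remainder splits into
  \<open>(1 - z) powr (1 - s) * real_polylog s z\<close>, which tends to the Gamma value, and a
  power of \<open>2 powr (- real N) / (1 - z)\<close>, whose base tends to \<open>1 / q\<close> by
  the first-order expansion of exp at 0.\<close>

lemma polylog_remainder_tendsto:
  assumes "s < 1" "q > 0"
  shows "(\<lambda>N. polylog_remainder s N q) \<longlonglongrightarrow> Gamma (1 - s) * q powr (s - 1)"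
proof -
  let ?z = "\<lambda>N. exp (- (2 powr (- real N) * q))"
  have z: "filterlim ?z (at_left 1) sequentially" using assms(2) by real_asymp
  have "(\<lambda>N. (1 - ?z N) powr (1 - s) * real_polylog s (?z N)) \<longlonglongrightarrow> Gamma (1 - s)"
    using filterlim_compose[OF real_polylog_tendsto_Gamma[OF assms(1)] z] .
  moreover have "(\<lambda>N. (2 powr (- real N) / (1 - ?z N)) powr (1 - s)) \<longlonglongrightarrow> inverse q powr (1 - s)"
  proof (intro tendsto_powr tendsto_const)
    show "(\<lambda>N. 2 powr (- real N) / (1 - ?z N)) \<longlonglongrightarrow> inverse q"
      using assms(2) by real_asymp
  qed (use assms in auto)
  ultimately have "(\<lambda>N. ((1 - ?z N) powr (1 - s) * real_polylog s (?z N)) *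
      (2 powr (- real N) / (1 - ?z N)) powr (1 - s)) \<longlonglongrightarrow> Gamma (1 - s) * inverse q powr (1 - s)"
    by (rule tendsto_mult)
  moreover have "((1 - ?z N) powr (1 - s) * real_polylog s (?z N)) *
      (2 powr (- real N) / (1 - ?z N)) powr (1 - s) = polylog_remainder s N q" for N
  proof -
    have "1 - ?z N > 0" using assms by simp
    then show ?thesis using assms
      by (simp add: polylog_remainder_def powr_divide powr_powr)
  qed
  moreover have "inverse q powr (1 - s) = q powr (s - 1)"
    using assms powr_minus_divide[of q "1 - s"] by (simp add: powr_divide inverse_eq_divide)
  ultimately show ?thesis by simp
qed

text \<open>Nonnegative coefficients make the remainder largest at \<open>q = 1\<close>, and there
  the sequence in \<open>N\<close> converges, hence is bounded.\<close>

lemma polylog_remainder_bounded: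
  assumes "s < 1"
  shows "\<exists>C. \<forall>N. \<forall>q\<ge>1. \<bar>polylog_remainder s N q\<bar> \<le> C"
proof -
  obtain C where C: "\<And>N. \<bar>polylog_remainder s N 1\<bar> \<le> C"
    using convergent_imp_Bseq[of "\<lambda>N. polylog_remainder s N 1"] polylog_remainder_tendsto[of s 1] assms
    by (auto simp: convergent_def Bseq_def)
  have "\<bar>polylog_remainder s N q\<bar> \<le> C" if "q \<ge> 1" for N q
  proof -
    have "\<bar>polylog_remainder s N q\<bar> \<le> polylog_remainder s N 1"
      unfolding polylog_remainder_def abs_mult using that
      by (auto intro!: mult_left_mono abs_real_polylog_le)
    also have "\<dots> \<le> C" using C[of N] by simp
    finally show ?thesis .
  qed
  then show ?thesis by blast
qed

section \<open>Primitives and the change of direction of integration\<close>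

text \<open>The right half-plane is convex and avoids the branch cut. One primitive there serves
  both the segments from \<open>x\<close> to \<open>R\<close> and the ray through
  \<open>x\<close>.\<close>

lemma primitive_of_incomplete_Gamma_integrand:
  fixes s :: complex
  obtains F where "\<And>z. Re z > 0 \<Longrightarrow> (F has_field_derivative z powr (s - 1) * exp (- z)) (at z)"
proof -
  let ?H = "{z. Re z > 0}"
  have H: "open ?H" "convex ?H" by (auto simp: open_halfspace_Re_gt convex_halfspace_Re_gt)
  have hol: "(\<lambda>z. z powr (s - 1) * exp (- z)) holomorphic_on ?H"
    by (intro holomorphic_intros) (auto simp: complex_nonpos_Reals_iff)
  show ?thesis
  proof (rule holomorphic_convex_primitive'[OF H(2,1) hol])
    fix F assume F: "\<And>z. z \<in> ?H \<Longrightarrow>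
      (F has_field_derivative z powr (s - 1) * exp (- z)) (at z within ?H)"
    show ?thesis
    proof (rule that)
      show "(F has_field_derivative z powr (s - 1) * exp (- z)) (at z)" if "Re z > 0" for z
        using F[of z] that at_within_open[OF _ H(1), of z] by simp
    qed
  qed
qed

lemma convex_Re_pos_segment:
  assumes "Re x > 0" "Re y > 0"
  shows "closed_segment x y \<subseteq> {z. Re z > 0}"
  using assms by (intro closed_segment_subset convex_halfspace_Re_gt) auto

lemma incomplete_Gamma_eq_Lim:
  assumes F: "\<And>z. Re z > 0 \<Longrightarrow> (F has_field_derivative z powr (s - 1) * exp (- z)) (at z)"
    and x: "Re x > 0" and L: "((\<lambda>R. F (of_real R)) \<longlongrightarrow> L) at_top"
  shows "incomplete_Gamma s x = L - F x"
  unfolding incomplete_Gamma_def integral_to_infinity_def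
proof (rule tendsto_Lim)
  have "contour_integral (linepath x (of_real R)) (\<lambda>t. t powr (s - 1) * exp (- t)) = F (of_real R) - F x"
    if "R > 0" for R :: real
  proof (rule contour_integral_unique)
    show "((\<lambda>t. t powr (s - 1) * exp (- t)) has_contour_integral F (of_real R) - F x) (linepath x (of_real R))"
      using contour_integral_primitive[where S = "{z. Re z > 0}" and f = F and
          f' = "\<lambda>t. t powr (s - 1) * exp (- t)" and g = "linepath x (of_real R)"]
        F convex_Re_pos_segment[OF x, of "of_real R"] that
      by (auto intro: DERIV_subset)
  qed
  then have "\<forall>\<^sub>F R in at_top. F (of_real R) - F x =
      contour_integral (linepath x (of_real R)) (\<lambda>t. t powr (s - 1) * exp (- t))"
    by (intro eventually_mono[OF eventually_gt_at_top[of 0]]) simp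
  moreover have "((\<lambda>R. F (of_real R) - F x) \<longlongrightarrow> L - F x) at_top"
    by (intro tendsto_intros L)
  ultimately show "((\<lambda>R. contour_integral (linepath x (of_real R)) (\<lambda>t. t powr (s - 1) * exp (- t)))
      \<longlongrightarrow> L - F x) at_top"
    using tendsto_cong by fast
qed simp

text \<open>The segment from \<open>R\<close> to \<open>R * x\<close> has length proportional to
  \<open>R\<close>, while the integrand decays exponentially on it.\<close>

lemma primitive_same_limit_on_rays:
  fixes s :: real
  assumes F: "\<And>z. Re z > 0 \<Longrightarrow> (F has_field_derivative z powr (of_real s - 1) * exp (- z)) (at z)"
    and x: "Re x > 0" and s: "s < 1"
  shows "((\<lambda>R. F (of_real R) - F (of_real R * x)) \<longlongrightarrow> 0) at_top"
proof (rule Lim_null_comparison)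
  \<comment> \<open>Both endpoints have real part at least \<open>R * m\<close>, so the segment
    stays in the half-plane \<open>?S\<close>, where the integrand is bounded.\<close>
  define m where "m = min 1 (Re x)"
  have m: "m > 0" using x by (simp add: m_def)
  show "\<forall>\<^sub>F R in at_top. norm (F (of_real R) - F (of_real R * x)) \<le>
      ((R * m) powr (s - 1) * exp (- (R * m))) * (R * norm (1 - x))"
    using eventually_gt_at_top[of 0]
  proof eventually_elim
    case (elim R)
    let ?S = "{z. Re z \<ge> R * m}"
    have Rm: "R * m > 0" using elim m by simp
    have "norm (F (of_real R) - F (of_real R * x)) \<le>
      ((R * m) powr (s - 1) * exp (- (R * m))) * norm (of_real R - of_real R * x)"
    proof (rule field_differentiable_bound[where S = ?S])
      show "convex ?S" by (rule convex_halfspace_Re_ge)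
      show "(F has_field_derivative z powr (of_real s - 1) * exp (- z)) (at z within ?S)"
        if "z \<in> ?S" for z using that Rm by (intro DERIV_subset[OF F]) auto
      show "norm (z powr (of_real s - 1) * exp (- z)) \<le> (R * m) powr (s - 1) * exp (- (R * m))"
        if "z \<in> ?S" for z
      proof -
        have z: "z \<noteq> 0" "norm z \<ge> R * m" using that Rm complex_Re_le_cmod[of z] by auto
        \<comment> \<open>The exponent is real, so the argument of \<open>z\<close> does not affect
          the modulus.\<close>
        have "norm (z powr of_real (s - 1)) = norm z powr (s - 1)"
          using z by (simp add: norm_powr_real_powr')
        also have "\<dots> \<le> (R * m) powr (s - 1)"
          using z Rm s by (intro powr_mono2') auto
        finally show ?thesis using that
          by (auto simp: norm_mult intro!: mult_mono)
      qed
      show "of_real R \<in> ?S" "of_real R * x \<in> ?S"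
        using elim by (auto simp: m_def)
    qed
    also have "norm (of_real R - of_real R * x) = R * norm (1 - x)"
      using elim by (metis abs_of_pos mult.right_neutral norm_mult norm_of_real right_diff_distrib)
    finally show ?case .
  qed
  have "((\<lambda>R. ((R * m) powr (s - 1) * exp (- (R * m))) * (R * c)) \<longlongrightarrow> 0) at_top" for c :: real
    using m by real_asymp
  then show "((\<lambda>R. ((R * m) powr (s - 1) * exp (- (R * m))) * (R * norm (1 - x))) \<longlongrightarrow> 0) at_top" .
qed

section \<open>Integrability and limits under the Laplace transform\<close>

lemma set_integrable_exp_minus:
  fixes r :: real
  assumes "r > 0"
  shows "set_integrable lborel {0..} (\<lambda>p. exp (- (p * r)))"
proof -
  have "(\<lambda>p. exp (- r * p)) absolutely_integrable_on {0..}"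
    using assms by (intro nonnegative_absolutely_integrable_1 integrable_on_exp_minus_to_infinity) auto
  then have "integrable lborel (\<lambda>p. indicator {0..} p *\<^sub>R exp (- r * p))"
    unfolding set_integrable_def by (subst (asm) integrable_completion) auto
  then show ?thesis unfolding set_integrable_def by (simp add: mult.commute)
qed

lemma laplace_convergent_bounded:
  assumes x: "Re x > 0" and [measurable]: "G \<in> borel_measurable borel"
    and bound: "\<And>p. p \<ge> 0 \<Longrightarrow> norm (G p) \<le> C"
  shows "laplace_convergent G x"
  unfolding laplace_convergent_def
proof (rule set_integrable_bound)
  show "set_integrable lborel {0..} (\<lambda>p. C * exp (- (p * Re x)))"
    using set_integrable_exp_minus[OF x] by (rule set_integrable_mult_right)
  show "set_borel_measurable lborel {0..} (\<lambda>p. G p * exp (- (of_real p * x)))"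
    unfolding set_borel_measurable_def by measurable
  have "norm (G p * exp (- (of_real p * x))) \<le> norm (C * exp (- (p * Re x)))" if "p \<ge> 0" for p
  proof -
    have "norm (G p) \<le> \<bar>C\<bar>" using bound[OF that] by simp
    then show ?thesis by (simp add: norm_mult abs_mult mult_right_mono)
  qed
  then show "AE p in lborel. p \<in> {0..} \<longrightarrow>
      norm (G p * exp (- (of_real p * x))) \<le> norm (C * exp (- (p * Re x)))" by simp
qed

lemma laplace_dominated_convergence:
  assumes x: "Re x > 0" and [measurable]: "\<And>N. G N \<in> borel_measurable borel" "g \<in> borel_measurable borel"
    and bound: "\<And>N p. p \<ge> 0 \<Longrightarrow> norm (G N p) \<le> C"
    and lim: "\<And>p. p \<ge> 0 \<Longrightarrow> (\<lambda>N. G N p) \<longlonglongrightarrow> g p"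
  shows "(\<lambda>N. laplace (G N) x) \<longlonglongrightarrow> laplace g x"
  unfolding laplace_def set_lebesgue_integral_def
proof (rule integral_dominated_convergence)
  have "set_integrable lborel {0..} (\<lambda>p. C * exp (- (p * Re x)))"
    using set_integrable_exp_minus[OF x] by (rule set_integrable_mult_right)
  then show "integrable lborel (\<lambda>p. indicat_real {0..} p *\<^sub>R (C * exp (- (p * Re x))))"
    unfolding set_integrable_def .
  show "AE p in lborel. (\<lambda>N. indicat_real {0..} p *\<^sub>R (G N p * exp (- (of_real p * x))))
      \<longlonglongrightarrow> indicat_real {0..} p *\<^sub>R (g p * exp (- (of_real p * x)))"
    using lim by (intro AE_I2) (auto simp: indicator_def intro!: tendsto_intros)
  show "AE p in lborel. norm (indicat_real {0..} p *\<^sub>R (G N p * exp (- (of_real p * x))))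
      \<le> indicat_real {0..} p *\<^sub>R (C * exp (- (p * Re x)))" for N
    using bound by (intro AE_I2) (auto simp: indicator_def norm_mult)
qed measurable

section \<open>The Laplace transform of the shifted power\<close>

text \<open>Substituting \<open>t = (p + 1) * x\<close> turns the transform into the integral along
  the ray from \<open>x\<close>. The limit of the primitive is stated separately because the
  treatment of erfc needs its existence.\<close>

lemma
  fixes s :: real
  assumes x: "Re x > 0" and s: "s < 1"
    and F: "\<And>z. Re z > 0 \<Longrightarrow> (F has_field_derivative z powr (of_real s - 1) * exp (- z)) (at z)"
  shows primitive_tendsto_at_top:
      "((\<lambda>R. F (of_real R)) \<longlongrightarrow> F x + x powr of_real s * exp (- x) * laplace (\<lambda>p. of_real ((p + 1) powr (s - 1))) x) at_top"
    and laplace_shifted_power: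
      "exp x * x powr (- of_real s) * incomplete_Gamma (of_real s) x = laplace (\<lambda>p. of_real ((p + 1) powr (s - 1))) x"
proof -
  define G :: "real \<Rightarrow> complex" where "G = (\<lambda>p. of_real ((p + 1) powr (s - 1)))"
  define I where "I = (\<lambda>T. LINT p:{0..T}|lborel. G p * exp (- (of_real p * x)))"
  have x0: "x \<noteq> 0" using x by auto
  have conv: "laplace_convergent G x"
  proof (rule laplace_convergent_bounded[OF x])
    show "norm (G p) \<le> 1" if "p \<ge> 0" for p
      using that s powr_mono2'[of "s - 1" 1 "p + 1"] by (simp add: G_def)
  qed (simp add: G_def)
  have I_lim: "(I \<longlongrightarrow> laplace G x) at_top"
    unfolding I_def laplace_def using conv
    by (intro tendsto_set_lebesgue_integral_at_top) (auto simp: laplace_convergent_def)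
  \<comment> \<open>The complex power splits over the product because \<open>p + 1\<close> is a
    positive real.\<close>
  have deriv: "x powr of_real s * exp (- x) * (G p * exp (- (of_real p * x))) =
      x * ((of_real (p + 1) * x) powr (of_real s - 1) * exp (- (of_real (p + 1) * x)))" if "p \<ge> 0" for p
  proof -
    have "(of_real (p + 1) * x) powr (of_real s - 1) =
        of_real ((p + 1) powr (s - 1)) * x powr (of_real s - 1)"
      using that x0 powr_times_real_left[of "of_real (p+1)" x "of_real s - 1"] powr_of_real[of "p + 1" "s - 1"]
      by simp
    moreover have "x powr of_real s = x * x powr (of_real s - 1)"
      using x0 by (simp add: powr_diff)
    moreover have "exp (- (of_real (p + 1) * x)) = exp (- x) * exp (- (of_real p * x))"
      by (simp add: exp_add[symmetric] algebra_simps)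
    ultimately show ?thesis by (simp add: G_def)
  qed
  have FTC: "x powr of_real s * exp (- x) * I T = F (of_real (T + 1) * x) - F x" if "T \<ge> 0" for T
  proof -
    let ?f = "\<lambda>p. x powr of_real s * exp (- x) * (G p * exp (- (of_real p * x)))"
    have "(LINT p:{0..T}|lborel. ?f p) = F (of_real (T + 1) * x) - F (of_real (0 + 1) * x)"
      unfolding set_lebesgue_integral_def
    proof (rule integral_FTC_atLeastAtMost)
      fix p :: real assume p: "0 \<le> p" "p \<le> T"
      have "Re (of_real (p + 1) * x) > 0" using p x by simp
      note dF = F[OF this]
      have "((\<lambda>p. of_real (p + 1) * x) has_vector_derivative x) (at p within {0..T})"
        by (auto intro!: derivative_eq_intros)
      from field_vector_diff_chain_within[OF this has_field_derivative_at_within[OF dF]]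
      have "((F \<circ> (\<lambda>p. of_real (p + 1) * x)) has_vector_derivative
          x * ((of_real (p + 1) * x) powr (of_real s - 1) * exp (- (of_real (p + 1) * x)))) (at p within {0..T})"
        .
      then show "((\<lambda>p. F (of_real (p + 1) * x)) has_vector_derivative ?f p) (at p within {0..T})"
        using deriv[OF p(1)] by (simp only: o_def)
    next
      show "continuous_on {0..T} ?f" unfolding G_def by (intro continuous_intros) auto
    qed (use that in simp)
    then show ?thesis by (simp add: I_def set_lebesgue_integral_def)
  qed
  have shift: "filterlim (\<lambda>R::real. R - 1) at_top at_top" by real_asymp
  \<comment> \<open>With \<open>R = T + 1\<close> the ray ends at \<open>R * x\<close>; the last
    summand moves this endpoint to \<open>R\<close> and vanishes in the limit.\<close>
  have "((\<lambda>R. F x + x powr of_real s * exp (- x) * I (R - 1) + (F (of_real R) - F (of_real R * x))) \<longlongrightarrow>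
      F x + x powr of_real s * exp (- x) * laplace G x + 0) at_top"
    by (intro tendsto_add tendsto_mult tendsto_const filterlim_compose[OF I_lim shift]
        primitive_same_limit_on_rays[OF F x s])
  moreover have "\<forall>\<^sub>F R in at_top. F x + x powr of_real s * exp (- x) * I (R - 1) +
      (F (of_real R) - F (of_real R * x)) = F (of_real R)"
    using eventually_ge_at_top[of 1] by eventually_elim (simp add: FTC)
  ultimately have "((\<lambda>R. F (of_real R)) \<longlongrightarrow> F x + x powr of_real s * exp (- x) * laplace G x + 0) at_top"
    using tendsto_cong by fast
  then show lim: "((\<lambda>R. F (of_real R)) \<longlongrightarrow>
      F x + x powr of_real s * exp (- x) * laplace (\<lambda>p. of_real ((p + 1) powr (s - 1))) x) at_top"
    by (simp add: G_def)
  have "incomplete_Gamma (of_real s) x =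
      x powr of_real s * exp (- x) * laplace (\<lambda>p. of_real ((p + 1) powr (s - 1))) x"
    using incomplete_Gamma_eq_Lim[OF F x lim] by simp
  then show "exp x * x powr (- of_real s) * incomplete_Gamma (of_real s) x = laplace (\<lambda>p. of_real ((p + 1) powr (s - 1))) x"
    using x0 by (simp add: exp_minus powr_minus field_simps)
qed

section \<open>The complementary error function\<close>

text \<open>If \<open>F\<close> is a primitive for \<open>s = 1 / 2\<close>, then
  \<open>F (w\<^sup>2) / 2\<close> is one for \<open>exp (- (w\<^sup>2))\<close>, so the integral
  from \<open>csqrt x\<close> is half of the incomplete Gamma function.\<close>

lemma erfc_csqrt:
  assumes x: "Re x > 0"
  shows "erfc (csqrt x) = incomplete_Gamma (1 / 2) x / of_real (sqrt pi)"
proof -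
  obtain F where F: "\<And>z. Re z > 0 \<Longrightarrow> (F has_field_derivative z powr (of_real (1 / 2) - 1) * exp (- z)) (at z)"
    using primitive_of_incomplete_Gamma_integrand[of "of_real (1 / 2)"] by blast
  obtain L where L: "((\<lambda>R. F (of_real R)) \<longlongrightarrow> L) at_top"
    using primitive_tendsto_at_top[OF x _ F] by auto
  have Gam: "incomplete_Gamma (1 / 2) x = L - F x"
    using incomplete_Gamma_eq_Lim[OF F x L] by simp
  \<comment> \<open>This open sector of half-angle pi/4 is convex and is mapped by squaring into the
    right half-plane, where \<open>F\<close> is known.\<close>
  let ?S = "{w. Re w > \<bar>Im w\<bar>}"
  have "convex ?S"
  proof -
    have "?S = {w. Re w - Im w > 0} \<inter> {w. Re w + Im w > 0}" by auto
    also have "\<dots> = {w. inner (Complex 1 (-1)) w > 0} \<inter> {w. inner (Complex 1 1) w > 0}"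
      by (simp add: inner_complex_def)
    also have "convex \<dots>" by (intro convex_Int convex_halfspace_gt)
    finally show ?thesis .
  qed
  have sq: "Re (w\<^sup>2) > 0" if "w \<in> ?S" for w
    using that by (simp add: Re_power2 power2_less_imp_less abs_le_square_iff[symmetric] flip: not_le)
  have start: "csqrt x \<in> ?S"
  proof -
    have "(Re (csqrt x))\<^sup>2 - (Im (csqrt x))\<^sup>2 > 0"
      using x by (metis Re_power2 power2_csqrt)
    then have "\<bar>Im (csqrt x)\<bar> < \<bar>Re (csqrt x)\<bar>"
      by (simp add: abs_le_square_iff del: csqrt.sel flip: not_le)
    moreover have "Re (csqrt x) \<ge> 0" by (rule Re_csqrt)
    ultimately show ?thesis by (simp del: csqrt.sel)
  qed
  have der: "((\<lambda>w. F (w\<^sup>2) / 2) has_field_derivative exp (- (w\<^sup>2))) (at w)" if w: "w \<in> ?S" for w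
  proof -
    have w': "Re w > 0" "w \<noteq> 0" using w by auto
    have "(w\<^sup>2) powr (of_real (1 / 2) - 1) = 1 / w"
    proof -
      have "(w\<^sup>2) powr (of_real (1 / 2) - 1) = (w\<^sup>2) powr (1/2) / w\<^sup>2"
        using w' powr_diff[of "w\<^sup>2" "1 / 2" 1] by simp
      \<comment> \<open>The principal root returns \<open>w\<close>, not \<open>- w\<close>, because
        \<open>Re w > 0\<close>.\<close>
      also have "(w\<^sup>2) powr (1/2) = w"
        using w' by (simp flip: csqrt_conv_powr add: csqrt_square)
      finally show ?thesis using w' by (simp add: power2_eq_square)
    qed
    then show ?thesis using w' F[OF sq[OF w]]
      by (auto intro!: derivative_eq_intros DERIV_chain2[of F])
  qed
  have "integral_to_infinity (\<lambda>t. exp (- (t\<^sup>2))) (csqrt x) = (L - F x) / 2"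
    unfolding integral_to_infinity_def
  proof (rule tendsto_Lim)
    have ci: "contour_integral (linepath (csqrt x) (of_real R)) (\<lambda>t. exp (- (t\<^sup>2))) =
        (F (of_real (R\<^sup>2)) - F x) / 2" if "R > 0" for R :: real
    proof -
      have "closed_segment (csqrt x) (of_real R) \<subseteq> ?S"
        using that start \<open>convex ?S\<close> by (intro closed_segment_subset) auto
      then have "((\<lambda>t. exp (- (t\<^sup>2))) has_contour_integral
          F ((of_real R)\<^sup>2) / 2 - F ((csqrt x)\<^sup>2) / 2) (linepath (csqrt x) (of_real R))"
        using contour_integral_primitive[where S = ?S and f = "\<lambda>w. F (w\<^sup>2) / 2" and
            f' = "\<lambda>t. exp (- (t\<^sup>2))" and g = "linepath (csqrt x) (of_real R)"] der
        by (auto intro: DERIV_subset)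
      then show ?thesis by (simp add: contour_integral_unique diff_divide_distrib)
    qed
    have "filterlim (\<lambda>R::real. R\<^sup>2) at_top at_top" by real_asymp
    from filterlim_compose[OF L this]
    have "((\<lambda>R. (F (of_real (R\<^sup>2)) - F x) / 2) \<longlongrightarrow> (L - F x) / 2) at_top"
      by (intro tendsto_intros) auto
    moreover have "\<forall>\<^sub>F R in at_top. (F (of_real (R\<^sup>2)) - F x) / 2 =
        contour_integral (linepath (csqrt x) (of_real R)) (\<lambda>t. exp (- (t\<^sup>2)))"
      using eventually_gt_at_top[of 0] by eventually_elim (simp add: ci)
    ultimately show "((\<lambda>R. contour_integral (linepath (csqrt x) (of_real R)) (\<lambda>t. exp (- (t\<^sup>2))))
        \<longlongrightarrow> (L - F x) / 2) at_top"
      using tendsto_cong by fast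
  qed simp
  then show ?thesis unfolding erfc_def Gam by (simp add: mult.commute)
qed

section \<open>Transforms of polylogarithms and the summation\<close>

lemma laplace_convergent_cong:
  assumes "\<And>p. p \<ge> 0 \<Longrightarrow> f p = g p"
  shows "laplace_convergent f x \<longleftrightarrow> laplace_convergent g x"
  unfolding laplace_convergent_def by (rule set_integrable_cong) (use assms in auto)

lemma laplace_cong:
  assumes "\<And>p. p \<ge> 0 \<Longrightarrow> f p = g p"
  shows "laplace f x = laplace g x"
  unfolding laplace_def by (rule set_lebesgue_integral_cong) (use assms in auto)

lemma laplace_diff:
  assumes "laplace_convergent f x" "laplace_convergent g x"
  shows "laplace (\<lambda>p. f p - g p) x = laplace f x - laplace g x"
  using set_integral_diff(2)[OF assms[unfolded laplace_convergent_def]]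
  by (simp add: laplace_def left_diff_distrib)

lemma laplace_mult_left: "laplace (\<lambda>p. c * f p) x = c * laplace f x"
  by (simp add: laplace_def mult.assoc)

lemma borel_measurable_real_polylog [measurable]: "real_polylog s \<in> borel_measurable borel"
  unfolding real_polylog_def[abs_def] by measurable

lemma borel_measurable_polylog_remainder [measurable]: "polylog_remainder s N \<in> borel_measurable borel"
  unfolding polylog_remainder_def[abs_def] by measurable

text \<open>Keeping the argument within radius \<open>r < 1\<close> bounds the integrand's
  polylogarithm by \<open>real_polylog s r\<close>.\<close>

lemma laplace_convergent_polylog:
  assumes x: "Re x > 0" and [measurable]: "h \<in> borel_measurable borel"
    and bound: "\<And>p. p \<ge> 0 \<Longrightarrow> \<bar>h p\<bar> \<le> r" and r: "r < 1"
  shows "laplace_convergent (\<lambda>p. polylog (of_real s) (of_real (h p))) x"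
proof -
  have "laplace_convergent (\<lambda>p. of_real (real_polylog s (h p))) x"
  proof (rule laplace_convergent_bounded[OF x])
    show "norm (of_real (real_polylog s (h p)) :: complex) \<le> real_polylog s r" if "p \<ge> 0" for p
      using abs_real_polylog_le[OF bound[OF that] r] by simp
  qed measurable
  then show ?thesis
  proof (subst laplace_convergent_cong)
    show "polylog (of_real s) (of_real (h p)) = of_real (real_polylog s (h p))" if "p \<ge> 0" for p
      using bound[OF that] r by (intro polylog_of_real) simp
  qed
qed

text \<open>The terms are the differences \<open>T k - T (Suc k)\<close> of transformed remainders,
  so the sum is \<open>T 0\<close> minus the limit of \<open>T\<close>, which is found by dominated
  convergence.\<close>

lemma laplace_polylog_sums:
  assumes x: "Re x > 0" and s: "s < 1"
  shows "(\<lambda>k. of_real (2 powr (- real (Suc k) * (1 - s))) *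
      laplace (\<lambda>p. polylog (of_real s) (of_real (- exp (- (2 powr (- real (Suc k))) * (p + 1))))) x)
    sums (laplace (\<lambda>p. polylog (of_real s) (of_real (exp (- p - 1)))) x -
      Gamma (1 - of_real s) * exp x * x powr (- of_real s) * incomplete_Gamma (of_real s) x)"
proof -
  obtain C where C: "\<And>N q. q \<ge> 1 \<Longrightarrow> \<bar>polylog_remainder s N q\<bar> \<le> C"
    using polylog_remainder_bounded[OF s] by blast
  define T where "T = (\<lambda>N. laplace (\<lambda>p. of_real (polylog_remainder s N (p + 1))) x)"
  have conv: "laplace_convergent (\<lambda>p. of_real (polylog_remainder s N (p + 1))) x" for N
    by (rule laplace_convergent_bounded[OF x, where C = C]) (use C in auto)
  have "T \<longlonglongrightarrow> laplace (\<lambda>p. of_real (Gamma (1 - s) * (p + 1) powr (s - 1))) x"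
    unfolding T_def
  proof (rule laplace_dominated_convergence[OF x, where C = C])
    show "(\<lambda>N. complex_of_real (polylog_remainder s N (p + 1))) \<longlonglongrightarrow>
        of_real (Gamma (1 - s) * (p + 1) powr (s - 1))" if "p \<ge> 0" for p
      using that s by (intro tendsto_of_real polylog_remainder_tendsto) auto
  qed (use C in auto)
  also have "laplace (\<lambda>p. of_real (Gamma (1 - s) * (p + 1) powr (s - 1))) x =
      of_real (Gamma (1 - s)) * laplace (\<lambda>p. of_real ((p + 1) powr (s - 1))) x"
    by (simp add: laplace_mult_left)
  also have "laplace (\<lambda>p. of_real ((p + 1) powr (s - 1))) x =
      exp x * x powr (- of_real s) * incomplete_Gamma (of_real s) x"
  proof (rule primitive_of_incomplete_Gamma_integrand[of "of_real s"])
    fix F assume "\<And>z. Re z > 0 \<Longrightarrow>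
      (F has_field_derivative z powr (of_real s - 1) * exp (- z)) (at z)"
    from laplace_shifted_power[OF x s this] show ?thesis by (rule sym)
  qed
  also have "of_real (Gamma (1 - s)) = Gamma (1 - complex_of_real s)"
    using Gamma_complex_of_real[of "1 - s"] by simp
  finally have T: "T \<longlonglongrightarrow> Gamma (1 - of_real s) * (exp x * x powr (- of_real s) * incomplete_Gamma (of_real s) x)" .
  have T0: "T 0 = laplace (\<lambda>p. polylog (of_real s) (of_real (exp (- p - 1)))) x"
    unfolding T_def
  proof (rule laplace_cong)
    show "of_real (polylog_remainder s 0 (p + 1)) = polylog (of_real s) (of_real (exp (- p - 1)))" if "p \<ge> 0" for p
      using that by (subst polylog_of_real) (auto simp: polylog_remainder_def)
  qed
  have step: "T k - T (Suc k) = of_real (2 powr (- real (Suc k) * (1 - s))) *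
      laplace (\<lambda>p. polylog (of_real s) (of_real (- exp (- (2 powr (- real (Suc k))) * (p + 1))))) x" for k
  proof -
    have "T k - T (Suc k) =
        laplace (\<lambda>p. of_real (polylog_remainder s k (p + 1)) - of_real (polylog_remainder s (Suc k) (p + 1))) x"
      unfolding T_def by (rule laplace_diff[OF conv conv, symmetric])
    also have "\<dots> = laplace (\<lambda>p. of_real (2 powr (- real (Suc k) * (1 - s))) *
        polylog (of_real s) (of_real (- exp (- (2 powr (- real (Suc k))) * (p + 1))))) x"
    proof (rule laplace_cong)
      fix p :: real assume p: "p \<ge> 0"
      have "polylog (of_real s) (of_real (- exp (- (2 powr (- real (Suc k))) * (p + 1)))) =
          of_real (real_polylog s (- exp (- (2 powr (- real (Suc k)) * (p + 1)))))"
        using p by (subst polylog_of_real) auto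
      then show "of_real (polylog_remainder s k (p + 1)) - of_real (polylog_remainder s (Suc k) (p + 1)) =
          of_real (2 powr (- real (Suc k) * (1 - s))) *
          polylog (of_real s) (of_real (- exp (- (2 powr (- real (Suc k))) * (p + 1))))"
        using p polylog_remainder_step[of "p + 1" s k] by (simp only: flip: of_real_diff of_real_mult)
    qed
    finally show ?thesis by (simp only: laplace_mult_left)
  qed
  show ?thesis using telescope_sums'[OF T] unfolding step T0 by (simp only: mult.assoc)
qed

theorem mainTheorem8:
  fixes x :: complex
  assumes "Re x > 0"
  shows
    "(\<forall>s::real. s < 1 \<longrightarrow>
        laplace_convergent (\<lambda>p. polylog (of_real s) (of_real (exp (- p - 1)))) x \<and>
        (\<forall>k::nat. k \<ge> 1 \<longrightarrow>
           laplace_convergent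
             (\<lambda>p. polylog (of_real s) (of_real (- exp (- (2 powr (- real k)) * (p + 1))))) x) \<and>
        summable (\<lambda>k. of_real (2 powr (- real (Suc k) * (1 - s))) *
           laplace (\<lambda>p. polylog (of_real s)
             (of_real (- exp (- (2 powr (- real (Suc k))) * (p + 1))))) x) \<and>
        Gamma (1 - of_real s) * exp x * x powr (- of_real s) * incomplete_Gamma (of_real s) x =
          laplace (\<lambda>p. polylog (of_real s) (of_real (exp (- p - 1)))) x -
          (\<Sum>k. of_real (2 powr (- real (Suc k) * (1 - s))) *
             laplace (\<lambda>p. polylog (of_real s)
               (of_real (- exp (- (2 powr (- real (Suc k))) * (p + 1))))) x)) \<and>
     summable (\<lambda>k. of_real (2 powr (- real (Suc k) / 2)) *
        laplace (\<lambda>p. polylog (1 / 2)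
          (of_real (- exp (- (2 powr (- real (Suc k))) * (p + 1))))) x) \<and>
     of_real pi * exp x * x powr (- 1 / 2) * erfc (csqrt x) =
       laplace (\<lambda>p. polylog (1 / 2) (of_real (exp (- p - 1)))) x -
       (\<Sum>k. of_real (2 powr (- real (Suc k) / 2)) *
          laplace (\<lambda>p. polylog (1 / 2)
            (of_real (- exp (- (2 powr (- real (Suc k))) * (p + 1))))) x)"
proof -
  \<comment> \<open>The radii are the absolute values of the arguments at \<open>p = 0\<close>,
    where they are largest.\<close>
  have main: "laplace_convergent (\<lambda>p. polylog (of_real s) (of_real (exp (- p - 1)))) x"
    "laplace_convergent
       (\<lambda>p. polylog (of_real s) (of_real (- exp (- (2 powr (- real k)) * (p + 1))))) x" for s k
    using laplace_convergent_polylog[OF assms, of "\<lambda>p. exp (- p - 1)" "exp (- 1)" s]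
      laplace_convergent_polylog[OF assms, of "\<lambda>p. - exp (- (2 powr (- real k)) * (p + 1))"
        "exp (- (2 powr (- real k)))" s]
    by auto
  note sums = laplace_polylog_sums[OF assms]
  have one_half_less_one: "1 / 2 < (1 :: real)" by simp
  have half: "complex_of_real (1 / 2) = 1 / 2"
      "- real (Suc k) * (1 - 1 / 2) = - real (Suc k) / 2" for k
    by simp_all
  have eq: "Gamma (1 - 1 / 2) * exp x * x powr (- (1 / 2)) * incomplete_Gamma (1 / 2) x =
      of_real pi * exp x * x powr (- 1 / 2) * erfc (csqrt x)"
  proof -
    \<comment> \<open>One factor \<open>sqrt pi\<close> is this Gamma value and the other clears the
      denominator in \<open>erfc_csqrt\<close>; together they give \<open>pi\<close>.\<close>
    have "Gamma (1 - 1 / 2) = complex_of_real (sqrt pi)"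
      using Gamma_one_half_complex by simp
    moreover have "complex_of_real (sqrt pi) * of_real (sqrt pi) = of_real pi"
      by (simp flip: of_real_mult)
    ultimately show ?thesis
      unfolding erfc_csqrt[OF assms] by (simp add: field_simps)
  qed
  have half_sums:
    "(\<lambda>k. of_real (2 powr (- real (Suc k) / 2)) *
        laplace (\<lambda>p. polylog (1 / 2)
          (of_real (- exp (- (2 powr (- real (Suc k))) * (p + 1))))) x)
     sums (laplace (\<lambda>p. polylog (1 / 2) (of_real (exp (- p - 1)))) x -
       of_real pi * exp x * x powr (- 1 / 2) * erfc (csqrt x))"
    by (rule sums[of "1 / 2", OF one_half_less_one, unfolded half eq])
  with main sums show ?thesis
    by (auto simp only: sums_iff diff_diff_eq2 add_diff_cancel_left')
qed

end
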